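(* Let $X$ be a Banach space and let $Y$ be an almost isometric ideal ($ai$-ideal) in $X$. If $Y$ has $BHP$, then $X$ has $BHP$.
   Context: All Banach spaces are real and nontrivial ($\neq \{0\}$); $Y$ is a closed subspace of $X$. $B_X$ is the closed unit ball of $X$. A subspace $Y$ of $X$ is an almost isometric ideal ($ai$-ideal) in $X$ if for every $\varepsilon > 0$ and every finite dimensional subspace $E \subset X$ there exists a linear operator $T : E \to Y$ such that (1) $Te = e$ for all $e \in E \cap Y$, and (2) $\frac{1}{1+\varepsilon}\|e\| \leq \|Te\| \leq (1+\varepsilon)\|e\|$ for all $e \in E$. A Banach space $X$ has $BHP$ (ball huskable property) if for every $\varepsilon > 0$ there is a nonempty relatively weakly open subset of $B_X$ with (norm) diameter less than $\varepsilon$. *)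

theory Defs
  imports "HOL-Analysis.Analysis"
begin

(* A subspace S of the ambient space is a normed space in its own right; maps on S are total
   functions of which only the values on S matter. The whole space is S = UNIV. *)

definition linear_map_on :: "'a::real_vector set \<Rightarrow> ('a \<Rightarrow> 'b::real_vector) \<Rightarrow> bool" where
  "linear_map_on S f \<longleftrightarrow>
     (\<forall>x\<in>S. \<forall>y\<in>S. f (x + y) = f x + f y) \<and> (\<forall>c. \<forall>x\<in>S. f (c *\<^sub>R x) = c *\<^sub>R f x)"

definition dual_on :: "'a::real_normed_vector set \<Rightarrow> ('a \<Rightarrow> real) set" where
  "dual_on S = {f. linear_map_on S f \<and> (\<exists>K. \<forall>x\<in>S. \<bar>f x\<bar> \<le> K * norm x)}"

lemma dual_on_UNIV: "dual_on UNIV = {f. bounded_linear f}"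
  unfolding dual_on_def linear_map_on_def bounded_linear_def bounded_linear_axioms_def linear_iff
  by (auto simp: mult.commute)

(* The weak topology of S is induced by the functionals on S itself, not by restrictions of
   functionals on the ambient space. *)
definition weak_topology_on :: "'a::real_normed_vector set \<Rightarrow> 'a topology" where
  "weak_topology_on S =
     topology_generated_by {{x \<in> S. f x \<in> V} |f V. f \<in> dual_on S \<and> open V}"

lemma topspace_weak_topology_on: "topspace (weak_topology_on S) = S"
proof -
  have "(\<lambda>x. 0) \<in> dual_on S"
    by (auto simp: dual_on_def linear_map_on_def intro: exI[of _ 0])
  then have "S \<in> {{x \<in> S. f x \<in> V} |f V. f \<in> dual_on S \<and> open V}"
    by (intro CollectI exI[of _ "\<lambda>x. 0"] exI[of _ UNIV]) auto
  then show ?thesis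
    unfolding weak_topology_on_def topology_generated_by_topspace by blast
qed

(* The sets U are subsets of the unit ball, so diameter is not affected by its value 0 on
   unbounded sets. *)
definition BHP :: "'a::real_normed_vector set \<Rightarrow> bool" where
  "BHP S \<longleftrightarrow>
     (\<forall>\<epsilon>>0. \<exists>U. U \<noteq> {} \<and> openin (subtopology (weak_topology_on S) (S \<inter> cball 0 1)) U
        \<and> diameter U < \<epsilon>)"

definition ai_ideal :: "'a::real_normed_vector set \<Rightarrow> bool" where
  "ai_ideal Y \<longleftrightarrow>
     subspace Y \<and>
     (\<forall>\<epsilon>>0. \<forall>E. subspace E \<and> (\<exists>B. finite B \<and> E = span B) \<longrightarrow>
        (\<exists>T :: 'a \<Rightarrow> 'a. linear_map_on E T \<and> T ` E \<subseteq> Y \<and>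
           (\<forall>e\<in>E \<inter> Y. T e = e) \<and>
           (\<forall>e\<in>E. 1 / (1 + \<epsilon>) * norm e \<le> norm (T e) \<and> norm (T e) \<le> (1 + \<epsilon>) * norm e)))"

end

theory Submission
  imports Defs
begin

text \<open>
  The idea is to transport a small weakly open set from the ball of \<open>Y\<close> to the ball of \<open>X\<close>. For
  this, functionals on \<open>Y\<close> must be extended to \<open>X\<close> in a way that the almost isometries
  \<open>T : E \<rightarrow> Y\<close> respect asymptotically. Given \<open>f\<close> in the dual of \<open>Y\<close> and such a \<open>T\<close>, the numbers
  \<open>f (T x)\<close> are bounded by a multiple of \<open>norm x\<close> that does not depend on \<open>T\<close>, so by Tychonoff's
  theorem the maps \<open>(f, x) \<mapsto> f (T x)\<close> have a cluster point \<open>(f, x) \<mapsto> \<phi> f x\<close> as \<open>E\<close> grows and the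
  distortion tends to \<open>0\<close>. Passing to the limit, \<open>\<phi> f\<close> is linear, bounded and extends \<open>f\<close>
  (\<open>ai_ideal_extension\<close>).

  Now let \<open>U\<close> be a relatively weakly open subset of the ball of \<open>Y\<close>. Around one of its points it
  contains a set cut out by finitely many conditions \<open>f y \<in> V\<close>; let \<open>W\<close> be the set of all \<open>x\<close> in
  the ball of \<open>X\<close> with \<open>\<phi> f x \<in> V\<close> for the same pairs \<open>(f, V)\<close>. It contains that point, because
  \<open>\<phi> f\<close> extends \<open>f\<close>. For \<open>x\<close> and \<open>x'\<close> in \<open>W\<close> there are almost isometries \<open>T\<close> on the span of
  \<open>x\<close> and \<open>x'\<close> with \<open>f (T x)\<close> and \<open>f (T x')\<close> close to \<open>\<phi> f x\<close> and \<open>\<phi> f x'\<close>. As the sets \<open>V\<close> are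
  open, \<open>T x\<close> and \<open>T x'\<close> lie in \<open>U\<close> after they have been scaled back into the ball. Hence the
  distance of \<open>x\<close> and \<open>x'\<close> is at most the diameter of \<open>U\<close>, up to a factor that tends to \<open>1\<close>.
\<close>

section \<open>Basic weak neighbourhoods\<close>

lemma openin_weak_topology_on_basic:
  assumes "openin (weak_topology_on S) Q" and "y \<in> Q"
  obtains A where "finite A" "\<And>f V. (f, V) \<in> A \<Longrightarrow> f \<in> dual_on S \<and> open V \<and> f y \<in> V"
    "{x \<in> S. \<forall>(f, V)\<in>A. f x \<in> V} \<subseteq> Q"
proof -
  have "generate_topology_on {{x \<in> S. f x \<in> V} |f V. f \<in> dual_on S \<and> open V} Q"
    using assms(1) unfolding weak_topology_on_def by (rule openin_topology_generated_by)
  then have "\<exists>A. finite A \<and> (\<forall>(f, V)\<in>A. f \<in> dual_on S \<and> open V \<and> f y \<in> V) \<and>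
      {x \<in> S. \<forall>(f, V)\<in>A. f x \<in> V} \<subseteq> Q"
    using assms(2)
  proof (induction rule: generate_topology_on.induct)
    case Empty
    then show ?case by simp
  next
    case (Int a b)
    then have "y \<in> a" "y \<in> b" by simp_all
    from Int.IH(1)[OF \<open>y \<in> a\<close>] obtain A where A: "finite A"
      "\<forall>(f, V)\<in>A. f \<in> dual_on S \<and> open V \<and> f y \<in> V"
      "{x \<in> S. \<forall>(f, V)\<in>A. f x \<in> V} \<subseteq> a"
      by (elim exE conjE)
    from Int.IH(2)[OF \<open>y \<in> b\<close>] obtain A' where A': "finite A'"
      "\<forall>(f, V)\<in>A'. f \<in> dual_on S \<and> open V \<and> f y \<in> V"
      "{x \<in> S. \<forall>(f, V)\<in>A'. f x \<in> V} \<subseteq> b"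
      by (elim exE conjE)
    have "{x \<in> S. \<forall>(f, V)\<in>A \<union> A'. f x \<in> V} \<subseteq> a \<inter> b"
      unfolding ball_Un using A(3) A'(3) by blast
    with A(1,2) A'(1,2) show ?case
      by (intro exI[of _ "A \<union> A'"]) (simp add: ball_Un)
  next
    case (UN K)
    then obtain k where k: "k \<in> K" "y \<in> k" by blast
    from UN.IH[OF k] obtain A where A: "finite A"
      "\<forall>(f, V)\<in>A. f \<in> dual_on S \<and> open V \<and> f y \<in> V"
      "{x \<in> S. \<forall>(f, V)\<in>A. f x \<in> V} \<subseteq> k"
      by (elim exE conjE)
    have "{x \<in> S. \<forall>(f, V)\<in>A. f x \<in> V} \<subseteq> \<Union>K"
      using A(3) Union_upper[OF k(1)] by (rule subset_trans)
    with A(1,2) show ?case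
      by (intro exI[of _ A] conjI)
  next
    case (Basis s)
    then obtain f V where "s = {x \<in> S. f x \<in> V}" "f \<in> dual_on S" "open V"
      by blast
    then show ?case
      using Basis.prems by (intro exI[of _ "{(f, V)}"]) auto
  qed
  with that show ?thesis by blast
qed

lemma openin_weak_topology_on_finite:
  assumes "finite A" and "\<And>f V. (f, V) \<in> A \<Longrightarrow> g f \<in> dual_on S \<and> open V"
  shows "openin (weak_topology_on S) {x \<in> S. \<forall>(f, V)\<in>A. g f x \<in> V}"
proof -
  have "openin (weak_topology_on S) (case p of (f, V) \<Rightarrow> {x \<in> S. g f x \<in> V})" if "p \<in> A" for p
    using assms(2) that unfolding weak_topology_on_def
    by (cases p) (auto intro!: topology_generated_by_Basis)
  then have "openin (weak_topology_on S)
      ((\<Inter>p\<in>A. case p of (f, V) \<Rightarrow> {x \<in> S. g f x \<in> V}) \<inter> topspace (weak_topology_on S))"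
    using assms(1) by (rule openin_INT[rotated])
  also have "(\<Inter>p\<in>A. case p of (f, V) \<Rightarrow> {x \<in> S. g f x \<in> V}) \<inter> topspace (weak_topology_on S)
      = {x \<in> S. \<forall>(f, V)\<in>A. g f x \<in> V}"
    by (auto simp: topspace_weak_topology_on)
  finally show ?thesis .
qed


section \<open>Extending functionals along almost isometries\<close>

definition local_almost_isometry ::
    "'a::real_normed_vector set \<Rightarrow> 'a set \<Rightarrow> real \<Rightarrow> ('a \<Rightarrow> 'a) \<Rightarrow> bool" where
  "local_almost_isometry Y E \<epsilon> T \<longleftrightarrow>
     linear_map_on E T \<and> T ` E \<subseteq> Y \<and> (\<forall>e\<in>E \<inter> Y. T e = e) \<and>
     (\<forall>e\<in>E. 1 / (1 + \<epsilon>) * norm e \<le> norm (T e) \<and> norm (T e) \<le> (1 + \<epsilon>) * norm e)"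

lemma local_almost_isometry_mono:
  assumes "local_almost_isometry Y E \<epsilon> T" and "E' \<subseteq> E" and "0 < \<epsilon>" and "\<epsilon> \<le> \<epsilon>'"
  shows "local_almost_isometry Y E' \<epsilon>' T"
proof -
  have lower: "1 / (1 + \<epsilon>') * norm e \<le> 1 / (1 + \<epsilon>) * norm e" for e :: 'a
    using assms(3,4) by (intro mult_right_mono divide_left_mono) auto
  have upper: "(1 + \<epsilon>) * norm e \<le> (1 + \<epsilon>') * norm e" for e :: 'a
    using assms(4) by (intro mult_right_mono) auto
  have "1 / (1 + \<epsilon>') * norm e \<le> norm (T e) \<and> norm (T e) \<le> (1 + \<epsilon>') * norm e" if "e \<in> E'" for e
  proof -
    have "1 / (1 + \<epsilon>) * norm e \<le> norm (T e)" "norm (T e) \<le> (1 + \<epsilon>) * norm e"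
      using assms(1,2) that unfolding local_almost_isometry_def by blast+
    with lower[of e] upper[of e] show ?thesis by linarith
  qed
  moreover have "linear_map_on E' T" "T ` E' \<subseteq> Y" "\<forall>e\<in>E' \<inter> Y. T e = e"
    using assms(1,2) unfolding local_almost_isometry_def linear_map_on_def by blast+
  ultimately show ?thesis unfolding local_almost_isometry_def by blast
qed

lemma ai_ideal_local_almost_isometry:
  assumes "ai_ideal Y" and "finite B" and "0 < \<epsilon>"
  obtains T where "local_almost_isometry Y (span B) \<epsilon> T"
proof -
  have "subspace (span B) \<and> (\<exists>B'. finite B' \<and> span B = span B')"
    using assms(2) by auto
  with assms(1,3) show ?thesis
    using that unfolding ai_ideal_def local_almost_isometry_def by blast
qed

lemma closure_product_approx:
  fixes G :: "'i \<Rightarrow> real"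
  assumes "G \<in> closure S" and "finite J" and "0 < \<delta>"
  obtains G' where "G' \<in> S" "\<forall>j\<in>J. \<bar>G' j - G j\<bar> < \<delta>"
proof -
  have "open (\<Inter>j\<in>J. (\<lambda>G'. G' j) -` ball (G j) \<delta>)"
    using assms(2) by (intro open_INT ballI open_vimage) auto
  moreover have "G \<in> (\<Inter>j\<in>J. (\<lambda>G'. G' j) -` ball (G j) \<delta>)"
    using assms(3) by simp
  ultimately have "S \<inter> (\<Inter>j\<in>J. (\<lambda>G'. G' j) -` ball (G j) \<delta>) \<noteq> {}"
    using assms(1) closure_iff_nhds_not_empty by blast
  then show ?thesis
    using that by (auto simp: dist_real_def abs_minus_commute)
qed

lemma compact_product_box:
  fixes R :: "'i \<Rightarrow> real"
  shows "compact (PiE UNIV (\<lambda>i. {- R i..R i}))"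
proof -
  have "compactin (product_topology (\<lambda>_. euclidean) UNIV) (PiE UNIV (\<lambda>i. {- R i..R i}))"
    unfolding compactin_PiE by simp
  then show ?thesis
    by (simp add: euclidean_product_topology)
qed

text \<open>
  The cluster point, by Tychonoff's theorem: a pair of a finite set \<open>B\<close> and a tolerance confines
  the family of limits to a closed subset of a compact product of intervals, and these closed sets
  have the finite intersection property because enlarging \<open>B\<close> and shrinking the tolerance only
  strengthens the requirements on \<open>T\<close>.
\<close>

lemma ai_ideal_cluster_point:
  fixes Y :: "'a::real_normed_vector set"
  assumes "ai_ideal Y"
  obtains \<phi> :: "('a \<Rightarrow> real) \<Rightarrow> 'a \<Rightarrow> real" where
    "\<And>B \<Phi> n. finite B \<Longrightarrow> finite \<Phi> \<Longrightarrow> \<Phi> \<subseteq> dual_on Y \<Longrightarrow>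
       \<exists>T. local_almost_isometry Y (span B) (1 / Suc n) T \<and>
         (\<forall>f\<in>\<Phi>. \<forall>x\<in>B. \<bar>f (T x) - \<phi> f x\<bar> < 1 / Suc n)"
proof -
  have "\<exists>K\<ge>0. f \<in> dual_on Y \<longrightarrow> (\<forall>y\<in>Y. \<bar>f y\<bar> \<le> K * norm y)" for f
  proof (cases "f \<in> dual_on Y")
    case True
    then obtain K where K: "\<forall>y\<in>Y. \<bar>f y\<bar> \<le> K * norm y"
      unfolding dual_on_def by blast
    have "\<bar>f y\<bar> \<le> max K 0 * norm y" if "y \<in> Y" for y
      using K that mult_right_mono[of K "max K 0" "norm y"] by fastforce
    then show ?thesis by (intro exI[of _ "max K 0"]) auto
  qed auto
  then obtain K where K0: "\<And>f. K f \<ge> 0"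
    and K: "\<And>f y. f \<in> dual_on Y \<Longrightarrow> y \<in> Y \<Longrightarrow> \<bar>f y\<bar> \<le> K f * norm y"
    by metis
  \<comment> \<open>All tolerances are at most \<open>1\<close>, so \<open>2\<close> bounds the norms of the almost isometries.\<close>
  define R where "R = (\<lambda>(f, x :: 'a). K f * (2 * norm x))"
  define P where "P = PiE UNIV (\<lambda>i. {- R i..R i})"
  define Q where "Q = (\<lambda>(B, n). {G \<in> P. \<exists>T. local_almost_isometry Y (span B) (1 / Suc n) T \<and>
      (\<forall>f\<in>dual_on Y. \<forall>x\<in>B. G (f, x) = f (T x))})"
  define I where "I = {(B :: 'a set, n :: nat). finite B}"
  have "P \<inter> (\<Inter>i\<in>I. closure (Q i)) \<noteq> {}"
  proof (rule compact_imp_fip_image)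
    show "compact P"
      unfolding P_def by (rule compact_product_box)
  next
    fix I' assume I': "finite I'" "I' \<subseteq> I"
    define B where "B = (\<Union>i\<in>I'. fst i)"
    define n where "n = (\<Sum>i\<in>I'. snd i)"
    have "finite B"
      using I' unfolding B_def I_def by auto
    then obtain T where T: "local_almost_isometry Y (span B) (1 / Suc n) T"
      by (rule ai_ideal_local_almost_isometry[OF assms]) auto
    define G where "G = (\<lambda>(f, x). if f \<in> dual_on Y \<and> x \<in> B then f (T x) else 0)"
    have "\<bar>G (f, x)\<bar> \<le> R (f, x)" for f x
    proof (cases "f \<in> dual_on Y \<and> x \<in> B")
      case True
      then have x: "x \<in> span B" by (simp add: span_base)
      have "norm (T x) \<le> (1 + 1 / Suc n) * norm x"
        using T x unfolding local_almost_isometry_def by blast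
      also have "\<dots> \<le> 2 * norm x"
        by (intro mult_right_mono) (auto simp: field_simps)
      finally have "norm (T x) \<le> 2 * norm x" .
      moreover have "T x \<in> Y"
        using T x unfolding local_almost_isometry_def by blast
      ultimately have "\<bar>f (T x)\<bar> \<le> K f * (2 * norm x)"
        using K[of f "T x"] True K0[of f] mult_left_mono[of "norm (T x)" "2 * norm x" "K f"] by linarith
      then show ?thesis using True unfolding G_def R_def by simp
    qed (use K0[of f] in \<open>auto simp: G_def R_def\<close>)
    then have GP: "G \<in> P"
      unfolding P_def by (auto simp: abs_le_iff minus_le_iff)
    have "G \<in> Q i" if "i \<in> I'" for i
    proof -
      obtain B' m where i: "i = (B', m)" by fastforce
      have B': "B' \<subseteq> B" using that i unfolding B_def by force
      have "m \<le> n" using that i I'(1) member_le_sum[of i I' snd] unfolding n_def by auto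
      then have "1 / real (Suc n) \<le> 1 / real (Suc m)"
        by (intro divide_left_mono) auto
      then have "local_almost_isometry Y (span B') (1 / Suc m) T"
        using T span_mono[OF B'] by (intro local_almost_isometry_mono[OF T]) auto
      then show ?thesis
        using GP B' unfolding Q_def i G_def by auto
    qed
    then show "P \<inter> (\<Inter>i\<in>I'. closure (Q i)) \<noteq> {}"
      using GP closure_subset by blast
  qed auto
  then obtain G where G: "\<And>B n. finite B \<Longrightarrow> G \<in> closure (Q (B, n))"
    unfolding I_def by fast
  have "\<exists>T. local_almost_isometry Y (span B) (1 / Suc n) T \<and>
      (\<forall>f\<in>\<Phi>. \<forall>x\<in>B. \<bar>f (T x) - G (f, x)\<bar> < 1 / Suc n)"
    if fin: "finite B" "finite \<Phi>" and \<Phi>: "\<Phi> \<subseteq> dual_on Y" for B \<Phi> n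
  proof -
    obtain G' where G': "G' \<in> Q (B, n)" "\<forall>j\<in>\<Phi> \<times> B. \<bar>G' j - G j\<bar> < 1 / Suc n"
      using closure_product_approx[OF G[OF fin(1)], of "\<Phi> \<times> B" "1 / Suc n"] fin by auto
    then obtain T where T: "local_almost_isometry Y (span B) (1 / Suc n) T"
      "\<forall>f\<in>dual_on Y. \<forall>x\<in>B. G' (f, x) = f (T x)"
      unfolding Q_def by auto
    have "\<bar>f (T x) - G (f, x)\<bar> < 1 / Suc n" if "f \<in> \<Phi>" "x \<in> B" for f x
      using G'(2) T(2) \<Phi> that by fastforce
    with T(1) show ?thesis by blast
  qed
  then show ?thesis
    by (rule that[of "\<lambda>f x. G (f, x)"])
qed

text \<open>
  Linearity, boundedness and the extension property of \<open>\<phi> f\<close> each involve only finitely many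
  points, so each can be read off from a sequence of almost isometries along which the values at
  these points converge.
\<close>

lemma ai_ideal_extension:
  fixes Y :: "'a::real_normed_vector set"
  assumes "ai_ideal Y"
  obtains \<phi> :: "('a \<Rightarrow> real) \<Rightarrow> 'a \<Rightarrow> real" where
    "\<And>f. f \<in> dual_on Y \<Longrightarrow> \<phi> f \<in> dual_on UNIV"
    "\<And>f y. f \<in> dual_on Y \<Longrightarrow> y \<in> Y \<Longrightarrow> \<phi> f y = f y"
    "\<And>B \<Phi>. finite B \<Longrightarrow> finite \<Phi> \<Longrightarrow> \<Phi> \<subseteq> dual_on Y \<Longrightarrow>
       \<exists>T. (\<forall>n. local_almost_isometry Y (span B) (1 / Suc n) (T n)) \<and>
         (\<forall>f\<in>\<Phi>. \<forall>x\<in>B. (\<lambda>n. f (T n x)) \<longlonglongrightarrow> \<phi> f x)"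
proof -
  obtain \<phi> :: "('a \<Rightarrow> real) \<Rightarrow> 'a \<Rightarrow> real" where \<phi>:
    "\<And>B \<Phi> n. finite B \<Longrightarrow> finite \<Phi> \<Longrightarrow> \<Phi> \<subseteq> dual_on Y \<Longrightarrow>
       \<exists>T. local_almost_isometry Y (span B) (1 / Suc n) T \<and>
         (\<forall>f\<in>\<Phi>. \<forall>x\<in>B. \<bar>f (T x) - \<phi> f x\<bar> < 1 / Suc n)"
    using ai_ideal_cluster_point[OF assms] by blast
  have limit: "\<exists>T. (\<forall>n. local_almost_isometry Y (span B) (1 / Suc n) (T n)) \<and>
         (\<forall>f\<in>\<Phi>. \<forall>x\<in>B. (\<lambda>n. f (T n x)) \<longlonglongrightarrow> \<phi> f x)"
    if "finite B" "finite \<Phi>" "\<Phi> \<subseteq> dual_on Y" for B \<Phi>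
  proof -
    have "\<forall>n. \<exists>T. local_almost_isometry Y (span B) (1 / Suc n) T \<and>
        (\<forall>f\<in>\<Phi>. \<forall>x\<in>B. \<bar>f (T x) - \<phi> f x\<bar> < 1 / Suc n)"
      using \<phi>[OF that] by blast
    then obtain T where T: "\<And>n. local_almost_isometry Y (span B) (1 / Suc n) (T n)"
      "\<And>n f x. f \<in> \<Phi> \<Longrightarrow> x \<in> B \<Longrightarrow> \<bar>f (T n x) - \<phi> f x\<bar> < 1 / Suc n"
      by metis
    have "(\<lambda>n. f (T n x)) \<longlonglongrightarrow> \<phi> f x" if "f \<in> \<Phi>" "x \<in> B" for f x
      unfolding LIM_zero_iff[of _ "\<phi> f x", symmetric]
      by (rule Lim_null_comparison[OF always_eventually LIMSEQ_Suc[OF lim_1_over_n]])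
        (use T(2)[OF that] in \<open>auto simp: less_imp_le\<close>)
    with T(1) show ?thesis by blast
  qed
  have ext: "\<phi> f y = f y" if f: "f \<in> dual_on Y" and y: "y \<in> Y" for f y
  proof -
    obtain T where T: "\<And>n. local_almost_isometry Y (span {y}) (1 / Suc n) (T n)"
      "(\<lambda>n. f (T n y)) \<longlonglongrightarrow> \<phi> f y"
      using limit[of "{y}" "{f}"] f by auto
    have "T n y = y" for n
      using T(1)[of n] y span_base[of y "{y}"] unfolding local_almost_isometry_def by auto
    with T(2) show ?thesis by (simp add: LIMSEQ_const_iff)
  qed
  have dual: "\<phi> f \<in> dual_on UNIV" if f: "f \<in> dual_on Y" for f
  proof -
    have f_lin: "linear_map_on Y f"
      using f unfolding dual_on_def by blast
    have add: "\<phi> f (x + y) = \<phi> f x + \<phi> f y" for x y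
    proof -
      obtain T where T: "\<And>n. local_almost_isometry Y (span {x, y, x + y}) (1 / Suc n) (T n)"
        and lim: "(\<lambda>n. f (T n x)) \<longlonglongrightarrow> \<phi> f x" "(\<lambda>n. f (T n y)) \<longlonglongrightarrow> \<phi> f y"
          "(\<lambda>n. f (T n (x + y))) \<longlonglongrightarrow> \<phi> f (x + y)"
        using limit[of "{x, y, x + y}" "{f}"] f by auto
      have "f (T n (x + y)) = f (T n x) + f (T n y)" for n
      proof -
        have "x \<in> span {x, y, x + y}" "y \<in> span {x, y, x + y}"
          by (auto intro: span_base)
        then have "T n (x + y) = T n x + T n y" "T n x \<in> Y" "T n y \<in> Y"
          using T[of n] unfolding local_almost_isometry_def linear_map_on_def by blast+
        then show ?thesis using f_lin unfolding linear_map_on_def by simp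
      qed
      then show ?thesis
        using LIMSEQ_unique[OF lim(3)] tendsto_add[OF lim(1,2)] by simp
    qed
    have scale: "\<phi> f (c *\<^sub>R x) = c *\<^sub>R \<phi> f x" for c x
    proof -
      obtain T where T: "\<And>n. local_almost_isometry Y (span {x, c *\<^sub>R x}) (1 / Suc n) (T n)"
        and lim: "(\<lambda>n. f (T n x)) \<longlonglongrightarrow> \<phi> f x" "(\<lambda>n. f (T n (c *\<^sub>R x))) \<longlonglongrightarrow> \<phi> f (c *\<^sub>R x)"
        using limit[of "{x, c *\<^sub>R x}" "{f}"] f by auto
      have "f (T n (c *\<^sub>R x)) = c *\<^sub>R f (T n x)" for n
      proof -
        have "x \<in> span {x, c *\<^sub>R x}"
          by (auto intro: span_base)
        then have "T n (c *\<^sub>R x) = c *\<^sub>R T n x" "T n x \<in> Y"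
          using T[of n] unfolding local_almost_isometry_def linear_map_on_def by blast+
        then show ?thesis using f_lin unfolding linear_map_on_def by simp
      qed
      then show ?thesis
        using LIMSEQ_unique[OF lim(2)] tendsto_scaleR[OF tendsto_const lim(1), of c] by simp
    qed
    obtain K where K: "\<forall>y\<in>Y. \<bar>f y\<bar> \<le> K * norm y"
      using f unfolding dual_on_def by blast
    have bound: "\<bar>\<phi> f x\<bar> \<le> (\<bar>K\<bar> * 2) * norm x" for x
    proof -
      obtain T where T: "\<And>n. local_almost_isometry Y (span {x}) (1 / Suc n) (T n)"
        and lim: "(\<lambda>n. f (T n x)) \<longlonglongrightarrow> \<phi> f x"
        using limit[of "{x}" "{f}"] f by auto
      have "\<bar>f (T n x)\<bar> \<le> (\<bar>K\<bar> * 2) * norm x" for n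
      proof -
        have x: "x \<in> span {x}" by (simp add: span_base)
        have "\<bar>f (T n x)\<bar> \<le> K * norm (T n x)"
          using K T[of n] x unfolding local_almost_isometry_def by blast
        also have "\<dots> \<le> \<bar>K\<bar> * norm (T n x)"
          by (intro mult_right_mono) auto
        also have "norm (T n x) \<le> (1 + 1 / Suc n) * norm x"
          using T[of n] x unfolding local_almost_isometry_def by blast
        also have "\<dots> \<le> 2 * norm x"
          by (intro mult_right_mono) (auto simp: field_simps)
        finally show ?thesis by (simp add: mult_left_mono mult.assoc)
      qed
      then show ?thesis
        by (intro LIMSEQ_le_const2[OF tendsto_rabs[OF lim]]) blast
    qed
    show ?thesis
      unfolding dual_on_def linear_map_on_def using add scale bound by blast
  qed
  show ?thesis
    using that[OF dual ext limit] by blast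
qed


section \<open>Transporting small weakly open sets\<close>

text \<open>
  The sets cut out by finitely many conditions \<open>f y \<in> V\<close> in the ball of \<open>Y\<close> do not gain diameter
  when each \<open>f\<close> is replaced by its extension \<open>\<phi> f\<close>: two points of the larger set are carried into
  the smaller one by contractions \<open>1 / (1 + \<epsilon>) *\<^sub>R T\<close> that shrink their distance by a factor of at
  most \<open>(1 + \<epsilon>)\<^sup>2\<close>.
\<close>

lemma norm_diff_le_diameter_by_almost_isometries:
  fixes Y U :: "'a::real_normed_vector set"
  assumes "subspace Y"
    and "finite A" and A: "\<And>f V. (f, V) \<in> A \<Longrightarrow> f \<in> dual_on Y \<and> open V"
    and U: "{y \<in> Y \<inter> cball 0 1. \<forall>(f, V)\<in>A. f y \<in> V} \<subseteq> U" and "bounded U"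
    and T: "\<And>n. local_almost_isometry Y (span {x, x'}) (1 / Suc n) (T n)"
    and lim: "\<And>f b. f \<in> fst ` A \<Longrightarrow> b \<in> {x, x'} \<Longrightarrow> (\<lambda>n. f (T n b)) \<longlonglongrightarrow> \<phi> f b"
    and W: "\<And>b. b \<in> {x, x'} \<Longrightarrow> norm b \<le> 1 \<and> (\<forall>(f, V)\<in>A. \<phi> f b \<in> V)"
  shows "norm (x - x') \<le> diameter U"
proof -
  define r where "r = (\<lambda>n. 1 + 1 / real (Suc n))"
  have r_pos: "r n > 0" for n unfolding r_def by (simp add: add_pos_nonneg)
  have r_lim: "r \<longlonglongrightarrow> 1"
    unfolding r_def using tendsto_add[OF tendsto_const LIMSEQ_Suc[OF lim_1_over_n], of 1] by simp
  have span: "x \<in> span {x, x'}" "x' \<in> span {x, x'}" "- x' \<in> span {x, x'}" "x - x' \<in> span {x, x'}"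
    by (auto intro: span_base span_neg span_diff)
  have TY: "T n b \<in> Y" if "b \<in> {x, x'}" for n b
    using T[of n] span that unfolding local_almost_isometry_def by blast
  have in_U: "eventually (\<lambda>n. (1 / r n) *\<^sub>R T n b \<in> U) sequentially" if b: "b \<in> {x, x'}" for b
  proof -
    have "eventually (\<lambda>n. f ((1 / r n) *\<^sub>R T n b) \<in> V) sequentially" if "(f, V) \<in> A" for f V
    proof -
      have eq: "f ((1 / r n) *\<^sub>R T n b) = (1 / r n) *\<^sub>R f (T n b)" for n
        using A[OF that] TY[OF b, of n] unfolding dual_on_def linear_map_on_def by blast
      have "f \<in> fst ` A" using that by force
      then have "(\<lambda>n. (1 / r n) *\<^sub>R f (T n b)) \<longlonglongrightarrow> (1 / 1) *\<^sub>R \<phi> f b"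
        by (intro tendsto_intros r_lim lim b) auto
      then show ?thesis
        unfolding eq using A[OF that] W[OF b] that by (intro topological_tendstoD) auto
    qed
    then have "eventually (\<lambda>n. \<forall>p\<in>A. case p of (f, V) \<Rightarrow> f ((1 / r n) *\<^sub>R T n b) \<in> V) sequentially"
      by (intro eventually_ball_finite \<open>finite A\<close>) auto
    then show ?thesis
    proof eventually_elim
      case (elim n)
      have "norm (T n b) \<le> r n * norm b"
        using T[of n] span b unfolding local_almost_isometry_def r_def by blast
      also have "\<dots> \<le> r n"
        using W[OF b] r_pos[of n] by (intro mult_left_le) auto
      finally have "(1 / r n) *\<^sub>R T n b \<in> cball 0 1"
        using r_pos[of n] by (simp add: field_simps)
      moreover have "(1 / r n) *\<^sub>R T n b \<in> Y"
        using \<open>subspace Y\<close> TY[OF b] by (rule subspace_scale)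
      ultimately show ?case using elim U by blast
    qed
  qed
  have "eventually (\<lambda>n. norm (x - x') \<le> r n * (r n * diameter U)) sequentially"
    using in_U[of x, simplified] in_U[of x', simplified]
  proof eventually_elim
    case (elim n)
    have lin: "T n (x + - x') = T n x + T n (- x')" "T n ((- 1) *\<^sub>R x') = (- 1) *\<^sub>R T n x'"
      using T[of n] span unfolding local_almost_isometry_def linear_map_on_def by blast+
    have "norm (x - x') \<le> r n * norm (T n (x - x'))"
    proof -
      have "1 / r n * norm (x - x') \<le> norm (T n (x - x'))"
        using T[of n] span unfolding local_almost_isometry_def r_def by blast
      then show ?thesis using r_pos[of n] by (simp add: field_simps)
    qed
    also have "T n (x - x') = r n *\<^sub>R ((1 / r n) *\<^sub>R T n x - (1 / r n) *\<^sub>R T n x')"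
      using lin r_pos[of n] by (simp add: scaleR_diff_right)
    also have "norm \<dots> = r n * dist ((1 / r n) *\<^sub>R T n x) ((1 / r n) *\<^sub>R T n x')"
      using r_pos[of n] by (simp add: dist_norm)
    also have "dist ((1 / r n) *\<^sub>R T n x) ((1 / r n) *\<^sub>R T n x') \<le> diameter U"
      using elim by (intro diameter_bounded_bound \<open>bounded U\<close>)
    finally show ?case using r_pos[of n] by (simp add: mult_left_mono)
  qed
  moreover have "(\<lambda>n. r n * (r n * diameter U)) \<longlonglongrightarrow> 1 * (1 * diameter U)"
    by (intro tendsto_intros r_lim)
  ultimately show ?thesis
    using tendsto_lowerbound[of "\<lambda>n. r n * (r n * diameter U)"] by simp
qed

theorem proposition2p15:
  fixes Y :: "'a::banach set"
  assumes "closed Y" and "Y \<noteq> {0}"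
    and "ai_ideal Y"
    and "BHP Y"
  shows "BHP (UNIV :: 'a set)"
  unfolding BHP_def
proof (intro allI impI)
  fix \<epsilon> :: real assume "\<epsilon> > 0"
  then obtain U where "U \<noteq> {}" and small: "diameter U < \<epsilon>"
    and "openin (subtopology (weak_topology_on Y) (Y \<inter> cball 0 1)) U"
    using \<open>BHP Y\<close> unfolding BHP_def by blast
  then obtain Q y where Q: "openin (weak_topology_on Y) Q" and U: "U = Q \<inter> (Y \<inter> cball 0 1)"
    and y: "y \<in> U"
    unfolding openin_subtopology by blast
  obtain A where A: "finite A" "\<And>f V. (f, V) \<in> A \<Longrightarrow> f \<in> dual_on Y \<and> open V \<and> f y \<in> V"
    "{z \<in> Y. \<forall>(f, V)\<in>A. f z \<in> V} \<subseteq> Q"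
    using openin_weak_topology_on_basic[OF Q, of y] y U by blast
  obtain \<phi> where \<phi>: "\<And>f. f \<in> dual_on Y \<Longrightarrow> \<phi> f \<in> dual_on UNIV"
    "\<And>f z. f \<in> dual_on Y \<Longrightarrow> z \<in> Y \<Longrightarrow> \<phi> f z = f z"
    and limit: "\<And>B \<Phi>. finite B \<Longrightarrow> finite \<Phi> \<Longrightarrow> \<Phi> \<subseteq> dual_on Y \<Longrightarrow>
       \<exists>T. (\<forall>n. local_almost_isometry Y (span B) (1 / Suc n) (T n)) \<and>
         (\<forall>f\<in>\<Phi>. \<forall>x\<in>B. (\<lambda>n. f (T n x)) \<longlonglongrightarrow> \<phi> f x)"
    using ai_ideal_extension[OF \<open>ai_ideal Y\<close>] by blast
  define W where "W = {x \<in> UNIV. \<forall>(f, V)\<in>A. \<phi> f x \<in> V} \<inter> (UNIV \<inter> cball 0 1)"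
  have "openin (subtopology (weak_topology_on UNIV) (UNIV \<inter> cball 0 1)) W"
    unfolding W_def
    by (intro openin_subtopology_Int openin_weak_topology_on_finite) (use A \<phi> in auto)
  moreover have "y \<in> W"
    using y U A(2) \<phi>(2) unfolding W_def by fastforce
  moreover have "diameter W \<le> diameter U"
  proof (rule diameter_le)
    fix x x' assume W: "x \<in> W" "x' \<in> W"
    have "fst ` A \<subseteq> dual_on Y"
      using A(2) by auto
    then obtain T where T: "\<And>n. local_almost_isometry Y (span {x, x'}) (1 / Suc n) (T n)"
      "\<And>f b. f \<in> fst ` A \<Longrightarrow> b \<in> {x, x'} \<Longrightarrow> (\<lambda>n. f (T n b)) \<longlonglongrightarrow> \<phi> f b"
      using limit[of "{x, x'}" "fst ` A"] A(1) by blast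
    show "norm (x - x') \<le> diameter U"
    proof (rule norm_diff_le_diameter_by_almost_isometries[where T = T and A = A and \<phi> = \<phi>])
      show "subspace Y"
        using \<open>ai_ideal Y\<close> unfolding ai_ideal_def by blast
      show "{z \<in> Y \<inter> cball 0 1. \<forall>(f, V)\<in>A. f z \<in> V} \<subseteq> U"
        using A(3) unfolding U by blast
      show "bounded U"
        unfolding U by (intro bounded_Int) auto
      show "norm b \<le> 1 \<and> (\<forall>(f, V)\<in>A. \<phi> f b \<in> V)" if "b \<in> {x, x'}" for b
        using that W unfolding W_def by auto
    qed (use A T in auto)
  qed (use \<open>y \<in> W\<close> in auto)
  ultimately show "\<exists>U. U \<noteq> {} \<and>
      openin (subtopology (weak_topology_on UNIV) (UNIV \<inter> cball (0 :: 'a) 1)) U \<and> diameter U < \<epsilon>"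
    using small by (intro exI[of _ W]) auto
qed

end
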